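(* Let $A$ and $B$ be solutions. If $A\otimes B$ is a solution, then $C\otimes B$ is a solution for any solution $C$.
   Context: A solution of size $N$ (to the $N$-Queens Problem) is a permutation $A$ of $\{1,\dots,N\}$ such that $|i-j|\neq|A(i)-A(j)|$ for all $1\le i<j\le N$; its size is denoted $|A|=N$. The composition $A\otimes B$ of arbitrary solutions $A$ and $B$ is the arrangement obtained by inserting a copy of the board $B$ at each queen position of $A$; explicitly it is the map $D$ on $\{1,\dots,|A||B|\}$ given by $$D(|B|(i-1)+j)=|B|(A(i)-1)+B(j),\qquad 1\le i\le |A|,\ 1\le j\le |B|.$$
   Formalization: The solution A is assumed to have size |A| ≥ 2; for |A| = 1 the claim is false, since then A⊗B = B is always a solution, yet for B = C = 2413 the composition C⊗B has attacking queens in columns 2 and 7. *)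

theory Defs
  imports "HOL-Combinatorics.Permutations"
begin

text \<open>
  A solution carries its size explicitly, since a permutation in the sense of \<open>permutes\<close>
  (a function that is the identity outside \<open>{1..N}\<close>) does not determine \<open>N\<close>.
  Differences are taken in \<open>int\<close> to avoid truncated subtraction.
\<close>

definition queens_solution :: "nat \<Rightarrow> (nat \<Rightarrow> nat) \<Rightarrow> bool" where
  "queens_solution N A \<longleftrightarrow>
     A permutes {1..N} \<and>
     (\<forall>i j. 1 \<le> i \<and> i < j \<and> j \<le> N \<longrightarrow> \<bar>int i - int j\<bar> \<noteq> \<bar>int (A i) - int (A j)\<bar>)"

text \<open>
  \<open>queens_compose M N A B\<close> is the composition of \<open>A\<close> of size \<open>M\<close> with \<open>B\<close> of size \<open>N\<close>.
  Every \<open>k\<close> in \<open>{1..M * N}\<close> is uniquely \<open>N * (i - 1) + j\<close> with \<open>i\<close> in \<open>{1..M}\<close> and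
  \<open>j\<close> in \<open>{1..N}\<close>, where \<open>i = (k - 1) div N + 1\<close> and \<open>j = (k - 1) mod N + 1\<close>;
  the lemma below recovers the defining equation. The value is \<open>k\<close> outside
  \<open>{1..M * N}\<close>, as \<open>permutes\<close> demands.
\<close>

definition queens_compose ::
    "nat \<Rightarrow> nat \<Rightarrow> (nat \<Rightarrow> nat) \<Rightarrow> (nat \<Rightarrow> nat) \<Rightarrow> nat \<Rightarrow> nat" where
  "queens_compose M N A B k =
     (if k \<in> {1..M * N}
      then N * (A ((k - 1) div N + 1) - 1) + B ((k - 1) mod N + 1)
      else k)"

lemma queens_compose_eq:
  assumes "i \<in> {1..M}" and "j \<in> {1..N}"
  shows "queens_compose M N A B (N * (i - 1) + j) = N * (A i - 1) + B j"
proof -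
  obtain a where a: "i = Suc a" "a < M" using assms(1) by (cases i) auto
  obtain b where b: "j = Suc b" "b < N" using assms(2) by (cases j) auto
  have "N * a + Suc b \<le> N * a + N" using b by simp
  also have "\<dots> = Suc a * N" by simp
  also have "\<dots> \<le> M * N" using a by (intro mult_le_mono1) simp
  finally have "N * a + Suc b \<in> {1..M * N}" by simp
  then show ?thesis using a b by (simp add: queens_compose_def)
qed

text \<open>
  The one-queen board is a degenerate left factor: composing it with any solution \<open>B\<close> gives
  back \<open>B\<close>, which says nothing about other left factors. Already \<open>B = 2413\<close> composed with
  itself is not a solution.
\<close>

lemma queens_compose_size_one:
  assumes "queens_solution N B"
  shows "queens_solution 1 id" and "queens_compose 1 N id B = B"
proof -
  show "queens_solution 1 id"
    by (simp add: queens_solution_def permutes_id)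
  have "B permutes {1..N}" using assms by (simp add: queens_solution_def)
  then show "queens_compose 1 N id B = B"
    by (auto simp: queens_compose_def fun_eq_iff permutes_def)
qed

lemma queens_compose_not_solution:
  defines "B \<equiv> id(1 := 2, 2 := 4, 3 := 1, 4 := (3 :: nat))"
  shows "queens_solution 4 B" and "\<not> queens_solution (4 * 4) (queens_compose 4 4 B B)"
proof -
  have set4: "{1..4 :: nat} = {1, 2, 3, 4}" by auto
  have "bij_betw B {1..4} {1..4}"
    unfolding bij_betw_def set4 by (auto simp: B_def inj_on_def)
  then have perm: "B permutes {1..4}"
    by (rule bij_imp_permutes) (auto simp: B_def)
  have "\<bar>int i - int j\<bar> \<noteq> \<bar>int (B i) - int (B j)\<bar>"
    if "1 \<le> i" "i < j" "j \<le> 4" for i j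
  proof -
    have "i \<in> {1, 2, 3, 4}" "j \<in> {1, 2, 3, 4}" using that by auto
    then show ?thesis using \<open>i < j\<close> by (auto simp: B_def)
  qed
  with perm show "queens_solution 4 B" by (simp add: queens_solution_def)
  have "queens_compose 4 4 B B 2 = 8" "queens_compose 4 4 B B 7 = 13"
    by (simp_all add: queens_compose_def B_def)
  then have "\<bar>int 2 - int 7\<bar> =
      \<bar>int (queens_compose 4 4 B B 2) - int (queens_compose 4 4 B B 7)\<bar>"
    by simp
  moreover have "(1::nat) \<le> 2" "(2::nat) < 7" "(7::nat) \<le> 4 * 4" by simp_all
  ultimately show "\<not> queens_solution (4 * 4) (queens_compose 4 4 B B)"
    unfolding queens_solution_def by blast
qed

end

theory Submission
  imports Defs
begin

text \<open>
  For a sign \<open>s\<close>, a queen in column \<open>i\<close> of \<open>A\<close> lies on the diagonal numbered \<open>i - s * A i\<close>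
  (\<open>s = 1\<close>) or on the antidiagonal with that number (\<open>s = - 1\<close>); a permutation is a solution
  exactly when both numberings are injective. The composition adds these numbers in base \<open>N\<close>:
  up to a constant, the number of the queen at place \<open>j\<close> in block \<open>i\<close> is
  \<open>N * (number of i in A) + (number of j in B)\<close>.

  The property of \<open>B\<close> that decides everything, and does not mention the left factor, is that
  \<open>B\<close> is a solution on the torus: its diagonal numbers are distinct even modulo \<open>N\<close>.

  If \<open>B\<close> is a torus solution, then the residue modulo \<open>N\<close> of a diagonal number of
  \<open>C \<otimes> B\<close> determines the place \<open>j\<close>, and the remaining summand determines the diagonal of
  \<open>C\<close> and so the block \<open>i\<close>. Hence \<open>C \<otimes> B\<close> is a solution whenever \<open>C\<close> is
  (\<open>queens_solution_compose\<close>).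

  If \<open>B\<close> is a solution but not a torus solution, then two of its diagonal numbers differ by a
  nonzero multiple of \<open>N\<close>. All of them lie in an interval of length \<open>2 * (N - 1)\<close>, so they differ
  by exactly \<open>N\<close>. A left factor \<open>A\<close> with two queens on consecutive diagonals can compensate this
  difference, which puts two queens of \<open>A \<otimes> B\<close> on one diagonal. Every solution of size at least
  two has such a pair (\<open>solution_adjacent_diagonals\<close>): otherwise its diagonal numbers would be
  spaced so widely that the two extreme diagonals, which are corners of the board, would both be
  occupied, and opposite corners attack each other. Hence if \<open>A \<otimes> B\<close> is a solution, then \<open>B\<close> is
  a torus solution (\<open>torus_solution_if_compose\<close>).
\<close>

definition diag :: "int \<Rightarrow> (nat \<Rightarrow> nat) \<Rightarrow> nat \<Rightarrow> int" where
  "diag s A i = int i - s * int (A i)"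

definition torus_solution :: "nat \<Rightarrow> (nat \<Rightarrow> nat) \<Rightarrow> bool" where
  "torus_solution N B \<longleftrightarrow> (\<forall>s. \<bar>s\<bar> = 1 \<longrightarrow> inj_on (\<lambda>j. diag s B j mod int N) {1..N})"

lemma queens_solution_iff_inj_diag:
  "queens_solution N A \<longleftrightarrow> A permutes {1..N} \<and> (\<forall>s. \<bar>s\<bar> = 1 \<longrightarrow> inj_on (diag s A) {1..N})"
proof (intro iffI conjI allI impI)
  assume sol: "queens_solution N A"
  then show "A permutes {1..N}" by (simp add: queens_solution_def)
  fix s :: int assume s: "\<bar>s\<bar> = 1"
  show "inj_on (diag s A) {1..N}"
  proof (rule linorder_inj_onI')
    fix i j assume ij: "i \<in> {1..N}" "j \<in> {1..N}" "i < j"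
    then have "\<bar>int i - int j\<bar> \<noteq> \<bar>int (A i) - int (A j)\<bar>"
      using sol by (simp add: queens_solution_def)
    moreover have "s = 1 \<or> s = - 1" using s by auto
    ultimately show "diag s A i \<noteq> diag s A j" by (auto simp: diag_def)
  qed
next
  assume R: "A permutes {1..N} \<and> (\<forall>s. \<bar>s\<bar> = 1 \<longrightarrow> inj_on (diag s A) {1..N})"
  have "\<bar>int i - int j\<bar> \<noteq> \<bar>int (A i) - int (A j)\<bar>" if "1 \<le> i" "i < j" "j \<le> N" for i j
  proof -
    have "inj_on (diag 1 A) {1..N}" "inj_on (diag (- 1) A) {1..N}" using R by auto
    then have "diag 1 A i \<noteq> diag 1 A j" "diag (- 1) A i \<noteq> diag (- 1) A j"
      using that by (auto dest!: inj_onD)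
    then show ?thesis by (auto simp: diag_def)
  qed
  with R show "queens_solution N A" by (simp add: queens_solution_def)
qed

lemma permutes_interval_dist:
  assumes "A permutes {1..N}" and "i \<in> {1..N}" and "j \<in> {1..N}"
  shows "\<bar>int (A i) - int (A j)\<bar> \<le> int N - 1"
proof -
  have "A i \<in> {1..N}" "A j \<in> {1..N}" using assms by (simp_all only: permutes_in_image)
  then show ?thesis by auto
qed

lemma diag_dist:
  assumes "A permutes {1..N}" and "\<bar>s\<bar> = 1" and "i \<in> {1..N}" and "j \<in> {1..N}"
  shows "\<bar>diag s A i - diag s A j\<bar> \<le> 2 * (int N - 1)"
proof -
  have "\<bar>int (A i) - int (A j)\<bar> \<le> int N - 1"
    using assms by (intro permutes_interval_dist)
  moreover have "\<bar>int i - int j\<bar> \<le> int N - 1" using assms(3,4) by auto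
  moreover have "s = 1 \<or> s = - 1" using assms(2) by auto
  ultimately show ?thesis by (auto simp: diag_def)
qed

section \<open>Consecutive diagonals\<close>

text \<open>
  The set and its translate by one are disjoint and live in an interval of \<open>2 * m\<close> integers,
  so together they fill it. The left end of the interval can then only come from the set, the
  right end only from the translate.
\<close>

lemma gapped_set_contains_ends:
  fixes S :: "int set"
  assumes sub: "S \<subseteq> {a..a + 2 * int m - 2}" and card: "card S = m" and "m \<ge> 1"
    and gap: "\<And>x. x \<in> S \<Longrightarrow> x + 1 \<notin> S"
  shows "a \<in> S" and "a + 2 * int m - 2 \<in> S"
proof -
  let ?T = "(\<lambda>x. x + 1) ` S" and ?I = "{a..a + 2 * int m - 1}"
  have fin: "finite S" using sub finite_subset by blast
  have "S \<inter> ?T = {}" using gap by auto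
  then have "card (S \<union> ?T) = 2 * m"
    using fin card by (simp add: card_Un_disjoint card_image)
  moreover have "S \<union> ?T \<subseteq> ?I" using sub by auto
  ultimately have full: "S \<union> ?T = ?I" by (intro card_subset_eq) auto
  have "a \<in> S \<union> ?T" using full \<open>m \<ge> 1\<close> by auto
  then show "a \<in> S" using sub by auto
  have "a + 2 * int m - 1 \<in> S \<union> ?T" using full \<open>m \<ge> 1\<close> by auto
  then show "a + 2 * int m - 2 \<in> S" using sub by (auto simp: algebra_simps)
qed

text \<open>
  Without such a pair, both ends of the range of diagonal numbers would be attained. A difference
  of \<open>2 * (M - 1)\<close> between two diagonal numbers forces the queens to be \<open>M - 1\<close> columns and
  \<open>M - 1\<close> rows apart, that is, to stand in opposite corners, on a common diagonal of the
  other direction. For \<open>M = 1\<close> the two corners coincide.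
\<close>

lemma solution_adjacent_diagonals:
  assumes sol: "queens_solution M A" and "2 \<le> M" and s: "\<bar>s\<bar> = 1"
  obtains i i' where "i \<in> {1..M}" and "i' \<in> {1..M}" and "diag s A i' = diag s A i + 1"
proof (rule ccontr)
  note adj = that
  assume none: "\<not> thesis"
  have perm: "A permutes {1..M}" and inj: "inj_on (diag s A) {1..M}"
    using sol s by (auto simp: queens_solution_iff_inj_diag)
  let ?S = "diag s A ` {1..M}"
  \<comment> \<open>The smallest conceivable diagonal number is \<open>1 - M\<close> for \<open>s = 1\<close> and \<open>2\<close> for \<open>s = - 1\<close>.\<close>
  define a where "a = (if s = 1 then 1 - int M else 2)"
  have s_cases: "s = 1 \<or> s = - 1" using s by auto
  have sub: "?S \<subseteq> {a..a + 2 * int M - 2}"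
  proof
    fix x assume "x \<in> ?S"
    then obtain i where i: "i \<in> {1..M}" "x = diag s A i" by auto
    moreover have "A i \<in> {1..M}" using i(1) by (simp only: permutes_in_image[OF perm])
    ultimately show "x \<in> {a..a + 2 * int M - 2}"
      using s_cases by (auto simp: diag_def a_def)
  qed
  have card: "card ?S = M" using inj by (simp add: card_image)
  have gap: "x + 1 \<notin> ?S" if "x \<in> ?S" for x
    using that none adj by (metis imageE)
  obtain i where i: "i \<in> {1..M}" "diag s A i = a"
    using gapped_set_contains_ends(1)[OF sub card _ gap] \<open>2 \<le> M\<close> by auto
  obtain i' where i': "i' \<in> {1..M}" "diag s A i' = a + 2 * int M - 2"
    using gapped_set_contains_ends(2)[OF sub card _ gap] \<open>2 \<le> M\<close> by auto
  have "diag s A i' - diag s A i = 2 * (int M - 1)" using i i' by simp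
  moreover have "\<bar>int (A i') - int (A i)\<bar> \<le> int M - 1"
    using perm i i' by (intro permutes_interval_dist)
  moreover have "\<bar>int i' - int i\<bar> \<le> int M - 1" using i i' by auto
  ultimately have "diag (- s) A i' = diag (- s) A i" and "i' \<noteq> i"
    using s_cases \<open>2 \<le> M\<close> by (auto simp: diag_def)
  moreover have "inj_on (diag (- s) A) {1..M}"
    using sol s by (simp add: queens_solution_iff_inj_diag)
  ultimately show False using i i' by (auto dest: inj_onD)
qed

section \<open>Diagonals of a composition\<close>

lemma block_position_in_range:
  fixes i j M N :: nat
  assumes "i \<in> {1..M}" and "j \<in> {1..N}"
  shows "N * (i - 1) + j \<in> {1..M * N}"
proof -
  have "N * (i - 1) + j \<le> N * (i - 1) + N" using assms(2) by simp
  also have "\<dots> = N * i" using assms by (cases i) auto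
  also have "\<dots> \<le> M * N" using assms by (simp add: mult.commute)
  finally show ?thesis using assms by simp
qed

lemma block_position_inj:
  fixes i i' j j' N :: nat
  assumes "1 \<le> i" and "1 \<le> i'" and "j \<in> {1..N}" and "j' \<in> {1..N}"
    and eq: "N * (i - 1) + j = N * (i' - 1) + j'"
  shows "i = i'" and "j = j'"
proof -
  have "N * (i - 1) + (j - 1) = N * (i' - 1) + (j' - 1)" using assms by auto
  then have "(N * (i - 1) + (j - 1)) div N = (N * (i' - 1) + (j' - 1)) div N" by simp
  moreover have "j - 1 < N" "j' - 1 < N" using assms by auto
  ultimately have "i - 1 = i' - 1" by simp
  then show "i = i'" using assms by simp
  then show "j = j'" using eq by simp
qed

lemma block_position_cases:
  fixes k M N :: nat
  assumes "k \<in> {1..M * N}"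
  obtains i j where "i \<in> {1..M}" and "j \<in> {1..N}" and "k = N * (i - 1) + j"
proof
  have pos: "0 < N" using assms by (cases N) auto
  have "k - 1 < M * N" using assms by auto
  then have "(k - 1) div N < M" by (simp add: less_mult_imp_div_less)
  then show "(k - 1) div N + 1 \<in> {1..M}" by simp
  have "(k - 1) mod N < N" using pos by simp
  then show "(k - 1) mod N + 1 \<in> {1..N}" by simp
  have "N * ((k - 1) div N) + (k - 1) mod N + 1 = k" using assms by simp
  then show "k = N * ((k - 1) div N + 1 - 1) + ((k - 1) mod N + 1)" by simp
qed

lemma queens_compose_permutes:
  assumes A: "A permutes {1..M}" and B: "B permutes {1..N}"
  shows "queens_compose M N A B permutes {1..M * N}"
proof -
  let ?D = "queens_compose M N A B"
  have A_in: "A i \<in> {1..M}" if "i \<in> {1..M}" for i using that by (simp only: permutes_in_image[OF A])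
  have B_in: "B j \<in> {1..N}" if "j \<in> {1..N}" for j using that by (simp only: permutes_in_image[OF B])
  have "?D ` {1..M * N} \<subseteq> {1..M * N}"
  proof
    fix y assume "y \<in> ?D ` {1..M * N}"
    then obtain k where k: "k \<in> {1..M * N}" "y = ?D k" by auto
    obtain i j where ij: "i \<in> {1..M}" "j \<in> {1..N}" "k = N * (i - 1) + j"
      using k(1) by (rule block_position_cases)
    then have "y = N * (A i - 1) + B j" using k(2) queens_compose_eq[OF ij(1,2)] by simp
    then show "y \<in> {1..M * N}" using block_position_in_range A_in B_in ij by metis
  qed
  moreover have "inj_on ?D {1..M * N}"
  proof (rule inj_onI)
    fix k k' assume k: "k \<in> {1..M * N}" and k': "k' \<in> {1..M * N}" and eq: "?D k = ?D k'"
    obtain i j where ij: "i \<in> {1..M}" "j \<in> {1..N}" "k = N * (i - 1) + j"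
      using k by (rule block_position_cases)
    obtain i' j' where ij': "i' \<in> {1..M}" "j' \<in> {1..N}" "k' = N * (i' - 1) + j'"
      using k' by (rule block_position_cases)
    have eq': "N * (A i - 1) + B j = N * (A i' - 1) + B j'"
      using eq queens_compose_eq[OF ij(1,2)] queens_compose_eq[OF ij'(1,2)] ij ij' by simp
    have pos: "1 \<le> A i" "1 \<le> A i'" using A_in ij ij' by auto
    have "A i = A i'" "B j = B j'"
      using block_position_inj[OF pos B_in[OF ij(2)] B_in[OF ij'(2)] eq'] by auto
    then have "i = i'" "j = j'" using permutes_inj[OF A] permutes_inj[OF B] by (auto dest: injD)
    then show "k = k'" using ij ij' by simp
  qed
  ultimately have "bij_betw ?D {1..M * N} {1..M * N}"
    by (simp add: bij_betw_def endo_inj_surj)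
  then show ?thesis
    by (rule bij_imp_permutes) (auto simp: queens_compose_def)
qed

text \<open>
  The last summand appears because rows and columns are counted from one; being the same for all
  queens, it cancels whenever two diagonals are compared.
\<close>

lemma diag_queens_compose:
  assumes A: "A permutes {1..M}" and "i \<in> {1..M}" and "j \<in> {1..N}"
  shows "diag s (queens_compose M N A B) (N * (i - 1) + j)
           = int N * diag s A i + diag s B j - int N * (1 - s)"
proof -
  have "A i \<in> {1..M}" using assms(2) by (simp only: permutes_in_image[OF A])
  then obtain a where a: "A i = Suc a" by (cases "A i") auto
  obtain b where b: "i = Suc b" using assms(2) by (cases i) auto
  show ?thesis
    unfolding diag_def queens_compose_eq[OF assms(2,3)] using a b by (simp add: algebra_simps)
qed

section \<open>Composition and the torus\<close>

lemma queens_solution_compose: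
  assumes C: "queens_solution K C" and B: "queens_solution N B" and torus: "torus_solution N B"
  shows "queens_solution (K * N) (queens_compose K N C B)"
  unfolding queens_solution_iff_inj_diag
proof (intro conjI allI impI)
  have Cp: "C permutes {1..K}" and Bp: "B permutes {1..N}"
    using C B by (auto simp: queens_solution_def)
  then show "queens_compose K N C B permutes {1..K * N}" by (rule queens_compose_permutes)
  fix s :: int assume s: "\<bar>s\<bar> = 1"
  show "inj_on (diag s (queens_compose K N C B)) {1..K * N}"
  proof (rule inj_onI)
    fix k k' assume k: "k \<in> {1..K * N}" and k': "k' \<in> {1..K * N}"
      and eq: "diag s (queens_compose K N C B) k = diag s (queens_compose K N C B) k'"
    obtain i j where ij: "i \<in> {1..K}" "j \<in> {1..N}" "k = N * (i - 1) + j"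
      using k by (rule block_position_cases)
    obtain i' j' where ij': "i' \<in> {1..K}" "j' \<in> {1..N}" "k' = N * (i' - 1) + j'"
      using k' by (rule block_position_cases)
    have eq': "int N * diag s C i + diag s B j = int N * diag s C i' + diag s B j'"
      using eq diag_queens_compose[OF Cp ij(1,2)] diag_queens_compose[OF Cp ij'(1,2)] ij ij'
      by simp
    then have "diag s B j mod int N = diag s B j' mod int N"
      by (metis mod_mult_self4)
    moreover have "inj_on (\<lambda>j. diag s B j mod int N) {1..N}"
      using torus s by (simp add: torus_solution_def)
    ultimately have j: "j = j'" using ij(2) ij'(2) by (simp only: inj_on_def)
    then have "diag s C i = diag s C i'" using eq' ij by auto
    moreover have "inj_on (diag s C) {1..K}"
      using C s by (simp add: queens_solution_iff_inj_diag)
    ultimately have "i = i'" using ij(1) ij'(1) by (simp only: inj_on_def)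
    then show "k = k'" using j ij ij' by simp
  qed
qed

text \<open>
  If \<open>B\<close> fails on the torus, two of its diagonals are exactly \<open>N\<close> apart. Placing the queen on
  the higher one in the block of the lower of two consecutive diagonals of \<open>A\<close>, and the
  other way round, makes the two differences cancel.
\<close>

lemma torus_solution_if_compose:
  assumes A: "queens_solution M A" and B: "queens_solution N B" and M: "2 \<le> M"
    and AB: "queens_solution (M * N) (queens_compose M N A B)"
  shows "torus_solution N B"
  unfolding torus_solution_def
proof (intro allI impI)
  fix s :: int assume s: "\<bar>s\<bar> = 1"
  have Ap: "A permutes {1..M}" and Bp: "B permutes {1..N}"
    using A B by (auto simp: queens_solution_def)
  obtain i i' where i: "i \<in> {1..M}" "i' \<in> {1..M}" and adj: "diag s A i' = diag s A i + 1"
    using solution_adjacent_diagonals[OF A M s] .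
  have not_N: "diag s B j - diag s B j' \<noteq> int N" if j: "j \<in> {1..N}" "j' \<in> {1..N}" for j j'
  proof
    assume "diag s B j - diag s B j' = int N"
    then have "diag s (queens_compose M N A B) (N * (i - 1) + j)
             = diag s (queens_compose M N A B) (N * (i' - 1) + j')"
      unfolding diag_queens_compose[OF Ap i(1) j(1)] diag_queens_compose[OF Ap i(2) j(2)] adj
      by (simp add: algebra_simps)
    moreover have "inj_on (diag s (queens_compose M N A B)) {1..M * N}"
      using AB s by (simp add: queens_solution_iff_inj_diag)
    ultimately have "N * (i - 1) + j = N * (i' - 1) + j'"
      using block_position_in_range i j by (blast dest: inj_onD)
    then have "i = i'" using block_position_inj(1) i j by (metis atLeastAtMost_iff)
    then show False using adj by simp
  qed
  show "inj_on (\<lambda>j. diag s B j mod int N) {1..N}"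
  proof (rule inj_onI)
    fix j j' assume j: "j \<in> {1..N}" "j' \<in> {1..N}"
      and "diag s B j mod int N = diag s B j' mod int N"
    then have "int N dvd diag s B j - diag s B j'" by (simp add: mod_eq_dvd_iff)
    then obtain q where q: "diag s B j - diag s B j' = int N * q" by (elim dvdE)
    have N: "0 < int N" using j by auto
    have "\<bar>int N * q\<bar> < int N * 2" using diag_dist[OF Bp s j] q by simp
    then have "\<bar>q\<bar> < 2" using N by (simp add: abs_mult)
    then have "q = - 1 \<or> q = 0 \<or> q = 1" by auto
    moreover have "q \<noteq> 1" using not_N[OF j] q by auto
    moreover have "q \<noteq> - 1" using not_N[OF j(2,1)] q by auto
    ultimately have "diag s B j = diag s B j'" using q by auto
    moreover have "inj_on (diag s B) {1..N}"
      using B s by (simp add: queens_solution_iff_inj_diag)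
    ultimately show "j = j'" using j by (simp only: inj_on_def)
  qed
qed

theorem corollary2p6:
  fixes M N :: nat and A B :: "nat \<Rightarrow> nat"
  assumes "queens_solution M A" and "queens_solution N B"
    and "2 \<le> M"
    and "queens_solution (M * N) (queens_compose M N A B)"
  shows "\<forall>K C. queens_solution K C \<longrightarrow> queens_solution (K * N) (queens_compose K N C B)"
  using queens_solution_compose torus_solution_if_compose assms by blast

end
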